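(* If $b = 5m \cdot 2^n$ for some odd integer $m > 1$ and some integer $n \ge 0$, then $$C_b = \frac{|S_b|}{b^4} = \frac{8 + 40 \cdot 4^n}{5 \cdot b^2} = \frac{8}{5 \cdot b^2} + \frac{8}{25 m^2}.$$
   Context: Let $b \ge 2$ be an integer. A four-digit base-$b$ number is an integer $x$ with $0 \le x < b^4$, written with exactly four base-$b$ digits (leading zeros allowed). The Kaprekar function $K_b$ maps such an $x$ to $K_b(x) = D - A$, where $D$ is the integer whose four base-$b$ digits are the digits of $x$ (with multiplicity, including leading zeros) arranged in descending order, and $A$ is the integer whose digits are the same digits arranged in ascending order. The result is again regarded as a four-digit base-$b$ number. $S_b$ is the set of four-digit base-$b$ numbers $x$ for which the sequence of iterates $K_b^t(x)$ is eventually a non-zero constant as $t$ increases. (When $5 \mid b$, it is known that $K_b$ has exactly one non-zero four-digit fixed point, so $S_b$ is the set of inputs which eventually reach it.) $C_b = |S_b|/b^4$ is the fraction of all four-digit inputs which lie in $S_b$. *)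

theory Defs
  imports Complex_Main
begin

text \<open>Lists of digits are read with the least significant digit first, as in \<^const>\<open>horner_sum\<close>.\<close>

definition digits4 :: "nat \<Rightarrow> nat \<Rightarrow> nat list" where
  "digits4 b x = map (\<lambda>i. x div b ^ i mod b) [0..<4]"

text \<open>Because the least significant digit comes first, the ascendingly sorted list
  denotes the number whose digits are written in descending order.\<close>

definition desc_number :: "nat \<Rightarrow> nat \<Rightarrow> nat" where
  "desc_number b x = horner_sum (\<lambda>d. d) b (sort (digits4 b x))"

definition asc_number :: "nat \<Rightarrow> nat \<Rightarrow> nat" where
  "asc_number b x = horner_sum (\<lambda>d. d) b (rev (sort (digits4 b x)))"

text \<open>The truncated subtraction is harmless: the descending arrangement is never
  smaller than the ascending one.\<close>

definition kaprekar :: "nat \<Rightarrow> nat \<Rightarrow> nat" where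
  "kaprekar b x = desc_number b x - asc_number b x"

definition kaprekar_set :: "nat \<Rightarrow> nat set" where
  "kaprekar_set b =
     {x. x < b ^ 4 \<and> (\<exists>c. c \<noteq> 0 \<and> (\<forall>\<^sub>F t in sequentially. (kaprekar b ^^ t) x = c))}"

definition kaprekar_fraction :: "nat \<Rightarrow> real" where
  "kaprekar_fraction b = real (card (kaprekar_set b)) / real b ^ 4"

end

theory Submission
  imports Defs "HOL-Combinatorics.Multiset_Permutations"
begin

text \<open>Let \<open>p\<close> be the difference of the largest and the smallest digit of \<open>x\<close> and \<open>q\<close> that of the two
  middle ones. Then \<open>K(x) = p(b\<^sup>3 - 1) + q(b\<^sup>2 - b)\<close>, so \<open>(p, q)\<close> determines the orbit. For \<open>q > 0\<close> the
  digits of \<open>K(x)\<close> are \<open>p, q - 1, b - 1 - q, b - p\<close>, hence the next pair consists of \<open>\<bar>2p - b\<bar>\<close> and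
  \<open>\<bar>2q - b\<bar>\<close>, unless these two coincide. The non-zero fixed point has the pair \<open>(3b/5, b/5)\<close>.

  Both exceptional cases (\<open>q = 0\<close>, or coinciding values) give a pair that is not divisible by the odd
  number \<open>m > 1\<close>, and \<open>m\<close> divides \<open>\<bar>2p - b\<bar>\<close> only if it divides \<open>p\<close>. So an orbit reaching the fixed
  point has pairs \<open>(my, mz)\<close> throughout. Modulo 5 the map \<open>y \<mapsto> \<bar>2y - b/m\<bar>\<close> is doubling up to
  sign, so the condition that one of \<open>y, z\<close> is \<open>\<plusminus>1\<close> and the other is \<open>\<plusminus>2\<close> modulo 5, equivalently
  \<open>(yz)\<^sup>2 \<equiv> 4\<close>, is invariant in both directions. Conversely, after \<open>n\<close> steps such a pair has become
  divisible by \<open>m2\<^sup>n = b/5\<close>, and one more step leads to \<open>(3b/5, b/5)\<close>.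

  A pair with \<open>p > q > 0\<close> arises from \<open>24(b - p)(p - q)\<close> inputs; it remains to add these
  numbers over all pairs \<open>(my, mz)\<close> as above.\<close>

subsection \<open>Digit differences\<close>

lemma digits4_eq: "digits4 b x = [x mod b, x div b mod b, x div b ^ 2 mod b, x div b ^ 3 mod b]"
  by (simp add: digits4_def numeral_eq_Suc)

lemma digits4_horner_sum:
  assumes "w0 < b" "w1 < b" "w2 < b" "w3 < b"
  shows "digits4 b (horner_sum (\<lambda>d. d) b [w0, w1, w2, w3]) = [w0, w1, w2, w3]"
  using assms
  by (simp add: digits4_eq power2_eq_square power3_eq_cube div_mult2_eq)

lemma horner_sum_digits4:
  assumes "x < b ^ 4"
  shows "horner_sum (\<lambda>d. d) b (digits4 b x) = x"
proof -
  have "x div b ^ 3 < b"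
    using assms by (simp add: less_mult_imp_div_less numeral_eq_Suc mult.assoc mult.commute)
  then have "x div b div b div b < b"
    by (simp add: power3_eq_cube div_mult2_eq)
  then show ?thesis
    by (simp add: digits4_eq power2_eq_square power3_eq_cube div_mult2_eq)
qed

lemma horner_sum_less_power:
  fixes b :: nat
  assumes "set l \<subseteq> {..<b}"
  shows "horner_sum (\<lambda>d. d) b l < b ^ length l"
  using assms
proof (induction l)
  case (Cons a l)
  then have "b * Suc (horner_sum (\<lambda>d. d) b l) \<le> b * b ^ length l"
    by (intro mult_le_mono2) auto
  with Cons.prems show ?case by simp
qed simp

text \<open>The witnesses \<open>d\<close> and \<open>e\<close> avoid truncated subtraction, and
  \<open>card_gap\<close> later counts over them.\<close>

definition gap :: "nat \<Rightarrow> nat \<Rightarrow> nat \<Rightarrow> nat \<Rightarrow> bool" where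
  "gap b x p q \<longleftrightarrow> (\<exists>d e. sort (digits4 b x) = [d, d + e, d + e + q, d + p] \<and> e + q \<le> p \<and> d + p < b)"

lemma gap_bounds: "gap b x p q \<Longrightarrow> q \<le> p \<and> p < b"
  by (auto simp: gap_def)

lemma gap_unique: "gap b x p q \<Longrightarrow> gap b x p' q' \<Longrightarrow> p = p' \<and> q = q'"
  by (auto simp: gap_def)

lemma gapI:
  assumes "mset (digits4 b x) = {#s0, s1, s2, s3#}"
    and "s0 \<le> s1" "s1 \<le> s2" "s2 \<le> s3" "s3 < b"
    and "p = s3 - s0" "q = s2 - s1"
  shows "gap b x p q"
proof -
  have "sort (digits4 b x) = [s0, s1, s2, s3]"
    using assms by (intro properties_for_sort) auto
  then show ?thesis
    unfolding gap_def using assms by (intro exI[of _ s0] exI[of _ "s1 - s0"]) auto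
qed

lemma gap_exists:
  assumes "b > 0"
  obtains p q where "gap b x p q"
proof -
  have "\<exists>s0 s1 s2 s3. l = [s0, s1, s2, s3]" if "length l = 4" for l :: "nat list"
    using that by (auto simp: numeral_eq_Suc length_Suc_conv)
  moreover have "length (sort (digits4 b x)) = 4" by (simp add: digits4_def)
  ultimately obtain s0 s1 s2 s3 where s: "sort (digits4 b x) = [s0, s1, s2, s3]"
    by meson
  have "sorted [s0, s1, s2, s3]" by (simp flip: s)
  moreover have "s3 \<in> set (digits4 b x)"
    by (metis s set_sort list.set_intros)
  then have "s3 < b" using assms by (auto simp: digits4_def)
  moreover have "mset (digits4 b x) = {#s0, s1, s2, s3#}"
    by (metis s mset_sort mset.simps)
  ultimately show thesis by (intro that[OF gapI]) auto
qed

text \<open>The extreme digits contribute with weight b^3 - 1, the middle ones with b^2 - b.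
  Negative terms stand on the left to stay within the naturals.\<close>

lemma kaprekar_gap:
  assumes "gap b x p q"
  shows "kaprekar b x + p + q * b = p * b ^ 3 + q * b ^ 2"
proof -
  from assms obtain d e where s: "sort (digits4 b x) = [d, d + e, d + e + q, d + p]"
    and "d + p < b" unfolding gap_def by blast
  then have "b \<ge> 1" by simp
  then have "p \<le> p * b ^ 3" "q * b \<le> q * b ^ 2" by (simp_all add: power2_eq_square)
  moreover have "desc_number b x + p + q * b = asc_number b x + p * b ^ 3 + q * b ^ 2"
    by (simp add: desc_number_def asc_number_def s algebra_simps power2_eq_square power3_eq_cube)
  ultimately show ?thesis unfolding kaprekar_def by linarith
qed

text \<open>The coefficients -p and -q force borrows, which end at the b^2 place because its
  coefficient \<open>q\<close> is positive.\<close>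

lemma digits4_kaprekar:
  assumes "gap b x p q" "q > 0"
  shows "digits4 b (kaprekar b x) = [b - p, b - 1 - q, q - 1, p]"
proof -
  have pq: "q \<le> p" "p < b" using gap_bounds[OF assms(1)] by auto
  have "int (kaprekar b x) = int p * int b ^ 3 + int q * int b ^ 2 - int p - int q * int b"
    using arg_cong[OF kaprekar_gap[OF assms(1)], of int] by simp
  also have "\<dots> = (int b - int p) + int b * ((int b - 1 - int q) + int b * ((int q - 1) + int b * int p))"
    by (simp add: algebra_simps power2_eq_square power3_eq_cube)
  also have "\<dots> = int (b - p) + int b * (int (b - 1 - q) + int b * (int (q - 1) + int b * int p))"
    using pq assms(2) by (simp add: of_nat_diff)
  also have "\<dots> = int (horner_sum (\<lambda>d. d) b [b - p, b - 1 - q, q - 1, p])"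
    by simp
  finally have "kaprekar b x = horner_sum (\<lambda>d. d) b [b - p, b - 1 - q, q - 1, p]"
    by linarith
  then show ?thesis using digits4_horner_sum[of "b - p" b "b - 1 - q" "q - 1" p] pq assms(2) by simp
qed

text \<open>With \<open>q = 0\<close> the borrow travels up to the leading digit and leaves
  \<open>b - 1\<close> twice.\<close>

lemma digits4_kaprekar_zero:
  assumes "gap b x p 0" "p > 0"
  shows "digits4 b (kaprekar b x) = [b - p, b - 1, b - 1, p - 1]"
proof -
  have pq: "p < b" using gap_bounds[OF assms(1)] by auto
  have "int (kaprekar b x) = int p * int b ^ 3 - int p"
    using arg_cong[OF kaprekar_gap[OF assms(1)], of int] by simp
  also have "\<dots> = int (horner_sum (\<lambda>d. d) b [b - p, b - 1, b - 1, p - 1])"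
    using pq assms(2)
    by (simp add: of_nat_diff algebra_simps power2_eq_square power3_eq_cube)
  finally have "kaprekar b x = horner_sum (\<lambda>d. d) b [b - p, b - 1, b - 1, p - 1]"
    by linarith
  then show ?thesis using digits4_horner_sum[of "b - p" b "b - 1" "b - 1" "p - 1"] pq assms(2) by simp
qed

text \<open>Truncated subtractions: this is the distance between \<open>2 * x\<close> and \<open>b\<close>.\<close>

definition tent :: "nat \<Rightarrow> nat \<Rightarrow> nat" where
  "tent b x = (2 * x - b) + (b - 2 * x)"

text \<open>Replacing \<open>p\<close> by \<open>b - p\<close>, or \<open>q\<close> by \<open>b - q\<close>, does not change the multiset of digits of the image,
  so both may be assumed to be at most \<open>b / 2\<close>.\<close>

lemma kaprekar_digits_folded:
  assumes "gap b x p q" "q > 0"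
  obtains r s where "mset (digits4 b (kaprekar b x)) = {#r, b - r, s - 1, b - 1 - s#}"
    and "0 < r" "2 * r \<le> b" "tent b p = b - 2 * r" "0 < s" "2 * s \<le> b" "tent b q = b - 2 * s"
proof -
  have pq: "q \<le> p" "p < b" using gap_bounds[OF assms(1)] by auto
  have fold: "\<exists>r. (y = r \<or> y = b - r) \<and> 0 < r \<and> 2 * r \<le> b" if "0 < y" "y < b" for y
    using that by (intro exI[of _ "min y (b - y)"]) auto
  obtain r where r: "p = r \<or> p = b - r" "0 < r" "2 * r \<le> b"
    using fold[of p] pq assms(2) by auto
  obtain s where s: "q = s \<or> q = b - s" "0 < s" "2 * s \<le> b"
    using fold[of q] pq assms(2) by auto
  have "{#b - p, p#} = {#r, b - r#}" "{#b - 1 - q, q - 1#} = {#s - 1, b - 1 - s#}"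
    using r s by auto
  moreover have "mset (digits4 b (kaprekar b x)) = {#b - p, p#} + {#b - 1 - q, q - 1#}"
    by (simp add: digits4_kaprekar[OF assms])
  ultimately have "mset (digits4 b (kaprekar b x)) = {#r, b - r#} + {#s - 1, b - 1 - s#}"
    by (simp only:)
  then show thesis using r s by (intro that[of r s]) (auto simp: tent_def)
qed

text \<open>The assumption on \<open>tent\<close> means r < s for the folded values, so the digits
  \<open>s - 1\<close> and \<open>b - 1 - s\<close> lie between \<open>r\<close> and
  \<open>b - r\<close>.\<close>

lemma gap_kaprekar_greater:
  assumes "gap b x p q" "q > 0" "tent b q < tent b p"
  shows "gap b (kaprekar b x) (tent b p) (tent b q)"
proof -
  obtain r s where "mset (digits4 b (kaprekar b x)) = {#r, b - r, s - 1, b - 1 - s#}"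
    and *: "0 < r" "2 * r \<le> b" "tent b p = b - 2 * r" "0 < s" "2 * s \<le> b" "tent b q = b - 2 * s"
    by (rule kaprekar_digits_folded[OF assms(1,2)])
  then have "mset (digits4 b (kaprekar b x)) = {#r, s - 1, b - 1 - s, b - r#}"
    by (simp add: add_mset_commute)
  then show ?thesis by (rule gapI) (use * assms(3) in auto)
qed

text \<open>Now s < r, and the digits stemming from \<open>q\<close> enclose those stemming from
  \<open>p\<close>.\<close>

lemma gap_kaprekar_less:
  assumes "gap b x p q" "q > 0" "tent b p < tent b q"
  shows "gap b (kaprekar b x) (tent b q) (tent b p)"
proof -
  obtain r s where "mset (digits4 b (kaprekar b x)) = {#r, b - r, s - 1, b - 1 - s#}"
    and *: "0 < r" "2 * r \<le> b" "tent b p = b - 2 * r" "0 < s" "2 * s \<le> b" "tent b q = b - 2 * s"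
    by (rule kaprekar_digits_folded[OF assms(1,2)])
  then have "mset (digits4 b (kaprekar b x)) = {#s - 1, r, b - r, b - 1 - s#}"
    by (simp add: add_mset_commute)
  then show ?thesis by (rule gapI) (use * assms(3) in auto)
qed

text \<open>For r = s the two digit pairs interleave. The second component is the absolute value of
  \<open>tent b p - 1\<close>, which also covers \<open>tent b p = 0\<close>.\<close>

lemma gap_kaprekar_equal:
  assumes "gap b x p q" "q > 0" "tent b p = tent b q"
  shows "gap b (kaprekar b x) (tent b p + 1) ((tent b p - 1) + (1 - tent b p))"
proof -
  obtain r s where dig: "mset (digits4 b (kaprekar b x)) = {#r, b - r, s - 1, b - 1 - s#}"
    and *: "0 < r" "2 * r \<le> b" "tent b p = b - 2 * r" "0 < s" "2 * s \<le> b" "tent b q = b - 2 * s"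
    by (rule kaprekar_digits_folded[OF assms(1,2)])
  have "s = r" using * assms(3) by auto
  show ?thesis
  proof (cases "2 * r = b")
    case True
    then have "mset (digits4 b (kaprekar b x)) = {#r - 1, r - 1, r, r#}"
      using dig \<open>s = r\<close> by (auto simp: add_mset_commute)
    then show ?thesis by (rule gapI) (use * True in auto)
  next
    case False
    have "mset (digits4 b (kaprekar b x)) = {#r - 1, r, b - 1 - r, b - r#}"
      using dig \<open>s = r\<close> by (simp add: add_mset_commute)
    then show ?thesis by (rule gapI) (use * False in auto)
  qed
qed

lemma gap_kaprekar_zero:
  assumes "gap b x p 0" "p > 0"
  shows "gap b (kaprekar b x) (b - 1 - min (p - 1) (b - p)) (b - 1 - max (p - 1) (b - p))"
proof (rule gapI)
  have pq: "p < b" using gap_bounds[OF assms(1)] by auto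
  show "mset (digits4 b (kaprekar b x)) = {#min (p - 1) (b - p), max (p - 1) (b - p), b - 1, b - 1#}"
    by (simp add: digits4_kaprekar_zero[OF assms] min_def max_def add_mset_commute)
  show "max (p - 1) (b - p) \<le> b - 1" "b - 1 < b" using pq assms(2) by auto
qed auto

subsection \<open>Orbits reaching the fixed point\<close>

lemma tent_mult: "tent (m * c) (m * y) = m * tent c y"
  by (simp add: tent_def algebra_simps diff_mult_distrib2)

lemma tent_cases: "2 * x = b + tent b x \<or> b = 2 * x + tent b x"
  by (auto simp: tent_def)

lemma dvd_tent: "k dvd b \<Longrightarrow> k dvd 2 * x \<Longrightarrow> k dvd tent b x"
  by (simp add: tent_def dvd_diff_nat)

text \<open>Up to sign, \<open>tent b x\<close> is 2x - b, and an odd \<open>m\<close> is coprime to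
  the factor 2.\<close>

lemma dvd_tent_iff:
  assumes "odd m" "m dvd b"
  shows "m dvd tent b x \<longleftrightarrow> m dvd x"
proof
  assume *: "m dvd tent b x"
  have "m dvd 2 * x"
    using * assms(2) tent_cases[of x b] by (metis dvd_add dvd_add_left_iff)
  moreover have "coprime m 2" using assms(1) by simp
  ultimately show "m dvd x" by (simp add: coprime_dvd_mult_right_iff)
qed (use assms(2) in \<open>simp add: dvd_tent\<close>)

text \<open>Squaring removes the absolute value, and \<open>c\<close> vanishes modulo 5.\<close>

lemma tent_square_mod_5:
  assumes "5 dvd c"
  shows "(tent c y)\<^sup>2 mod 5 = (2 * y)\<^sup>2 mod 5"
proof -
  obtain k where k: "c = 5 * k" using assms by auto
  have "int (tent c y) = \<bar>2 * int y - int c\<bar>" by (simp add: tent_def)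
  then have "int ((tent c y)\<^sup>2) = (2 * int y - int c)\<^sup>2" by simp
  also have "\<dots> = int ((2 * y)\<^sup>2) + 5 * (5 * int k ^ 2 - 4 * int y * int k)"
    by (simp add: k power2_eq_square algebra_simps)
  finally have "int ((tent c y)\<^sup>2) mod int 5 = int ((2 * y)\<^sup>2) mod int 5"
    by (simp only: mod_mult_self2 of_nat_numeral)
  then show ?thesis by (simp only: of_nat_eq_iff flip: zmod_int)
qed

text \<open>The last condition says that, modulo 5, one of \<open>p div m\<close>, \<open>q div m\<close> is \<open>\<plusminus>1\<close> and the
  other is \<open>\<plusminus>2\<close>.\<close>

definition good :: "nat \<Rightarrow> nat \<Rightarrow> nat \<Rightarrow> bool" where
  "good m p q \<longleftrightarrow> m dvd p \<and> m dvd q \<and> (p div m * (q div m))\<^sup>2 mod 5 = 4"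

lemma good_commute: "good m p q \<longleftrightarrow> good m q p"
  by (auto simp: good_def mult.commute)

lemma good_mult: "m > 0 \<Longrightarrow> good m (m * y) (m * z) \<longleftrightarrow> (y * z)\<^sup>2 mod 5 = 4"
  by (simp add: good_def)

lemma not_good_0: "\<not> good m p 0"
  by (simp add: good_def)

text \<open>For equal entries the square is a fourth power, hence 0 or 1 modulo 5.\<close>

lemma not_good_same: "\<not> good m p p"
proof -
  have "(w * w)\<^sup>2 mod 5 \<noteq> 4" for w :: nat
  proof -
    have "(w * w)\<^sup>2 mod 5 = ((w mod 5) * (w mod 5))\<^sup>2 mod 5"
      by (simp add: mod_mult_eq power_mod flip: power2_eq_square)
    moreover have "w mod 5 \<in> {0, 1, 2, 3, 4}" by auto
    ultimately show ?thesis by (auto simp: power2_eq_square)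
  qed
  then show ?thesis by (simp add: good_def)
qed

text \<open>Doubling both factors multiplies (yz)^2 by 16, which is 1 modulo 5.\<close>

lemma good_tent_iff:
  assumes "odd m" "5 dvd c"
  shows "good m (tent (m * c) p) (tent (m * c) q) \<longleftrightarrow> good m p q"
proof (cases "m dvd p \<and> m dvd q")
  case True
  then obtain y z where yz: "p = m * y" "q = m * z" unfolding dvd_def by blast
  have "m > 0" using assms(1) by (cases m) auto
  have "(tent c y * tent c z)\<^sup>2 mod 5 = ((2 * y)\<^sup>2 mod 5 * ((2 * z)\<^sup>2 mod 5)) mod 5"
    unfolding power_mult_distrib[of "tent c y"]
    by (metis mod_mult_eq tent_square_mod_5[OF assms(2)])
  also have "\<dots> = (16 * (y * z)\<^sup>2) mod 5"
    by (simp add: mod_mult_eq power_mult_distrib)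
  also have "\<dots> = ((y * z)\<^sup>2 + 5 * (3 * (y * z)\<^sup>2)) mod 5" by simp
  also have "\<dots> = (y * z)\<^sup>2 mod 5" by (rule mod_mult_self2)
  finally show ?thesis using \<open>m > 0\<close> by (simp add: yz tent_mult good_mult)
next
  case False
  then show ?thesis using assms(1) by (auto simp: good_def dvd_tent_iff)
qed

text \<open>Goodness excludes both \<open>q = 0\<close> and equal \<open>tent\<close> values, so
  only the regular cases remain.\<close>

lemma gap_kaprekar_good:
  assumes "gap b x p q" "good m p q" "b = m * c" "odd m" "5 dvd c"
  shows "tent b q < tent b p \<and> gap b (kaprekar b x) (tent b p) (tent b q) \<or>
    tent b p < tent b q \<and> gap b (kaprekar b x) (tent b q) (tent b p)"
proof -
  have "q > 0" using assms(2) not_good_0 by (cases q) auto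
  moreover have "tent b p \<noteq> tent b q"
    using assms good_tent_iff not_good_same by metis
  ultimately show ?thesis
    using assms(1) gap_kaprekar_greater gap_kaprekar_less by (meson linorder_neqE_nat)
qed

lemma gap_zero_iff: "gap b 0 p q \<longleftrightarrow> p = 0 \<and> q = 0 \<and> b > 0"
  by (auto simp: gap_def digits4_eq)

text \<open>The regular cases reduce to \<open>good_tent_iff\<close>; in the exceptional ones both
  sides are false.\<close>

lemma good_kaprekar_iff:
  assumes "gap b x p q" "gap b (kaprekar b x) p' q'" "b = m * c" "odd m" "m > 1" "5 dvd c"
  shows "good m p' q' \<longleftrightarrow> good m p q"
proof (cases "q = 0")
  case True
  have "\<not> good m p' q'"
  proof (cases "p = 0")
    case True
    then have "kaprekar b x = 0" using kaprekar_gap[OF assms(1)] \<open>q = 0\<close> by simp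
    then show ?thesis using assms(2) not_good_0 by (simp add: gap_zero_iff)
  next
    case False
    then have "gap b (kaprekar b x) (b - 1 - min (p - 1) (b - p)) (b - 1 - max (p - 1) (b - p))"
      using gap_kaprekar_zero assms(1) \<open>q = 0\<close> by auto
    then have "p' = b - 1 - min (p - 1) (b - p)" "q' = b - 1 - max (p - 1) (b - p)"
      using gap_unique[OF assms(2)] by auto
    \<comment> \<open>Since \<open>m\<close> divides \<open>b\<close>, it cannot also divide
      \<open>p' + q'\<close>, which is b - 1.\<close>
    then have "p' + q' + 1 = b" using False gap_bounds[OF assms(1)] by (auto simp: min_def max_def)
    show ?thesis
    proof
      assume "good m p' q'"
      then have "m dvd p' + q'" by (simp add: good_def)
      moreover have "m dvd p' + q' + 1" using \<open>p' + q' + 1 = b\<close> assms(3) by simp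
      ultimately have "m dvd 1" using dvd_add_right_iff by blast
      then show False using assms(5) by simp
    qed
  qed
  then show ?thesis using True not_good_0 by simp
next
  case False
  then have "q > 0" by simp
  consider "tent b q < tent b p" | "tent b p < tent b q" | "tent b p = tent b q" by linarith
  then show ?thesis
  proof cases
    case 1
    then show ?thesis
      using gap_unique[OF assms(2) gap_kaprekar_greater[OF assms(1) \<open>q > 0\<close> 1]] assms good_tent_iff
      by metis
  next
    case 2
    then show ?thesis
      using gap_unique[OF assms(2) gap_kaprekar_less[OF assms(1) \<open>q > 0\<close> 2]] assms good_tent_iff
        good_commute by metis
  next
    case 3
    let ?t = "tent b p"
    have "\<not> good m p q" using 3 good_tent_iff[OF assms(4,6)] not_good_same assms(3) by metis
    moreover have "\<not> good m p' q'"
    proof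
      assume "good m p' q'"
      then have "m dvd ?t + 1" "m dvd (?t - 1) + (1 - ?t)"
        using gap_unique[OF assms(2) gap_kaprekar_equal[OF assms(1) \<open>q > 0\<close> 3]] by (auto simp: good_def)
      \<comment> \<open>Either the two new differences are 2 apart or the larger one is 1; an odd
        \<open>m > 1\<close> divides neither 2 nor 1.\<close>
      moreover have "?t + 1 = (?t - 1) + (1 - ?t) + 2 \<or> ?t + 1 = 1" by auto
      ultimately have "m dvd 2 \<or> m dvd 1" by (metis dvd_add_right_iff)
      then have "m \<le> 2" by (auto dest: dvd_imp_le)
      then show False using assms(4,5) by (cases "m = 2") auto
    qed
    ultimately show ?thesis by simp
  qed
qed

section \<open>The fixed point and convergence to it\<close>

lemma gap_kaprekar_fixed_point:
  assumes "kaprekar b x = x" "x > 0" "gap b x p q" "b > 4"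
  shows "b = 5 * q \<and> p = 3 * q"
proof (cases "q = 0")
  case True
  have "p \<noteq> 0" using kaprekar_gap[OF assms(3)] True assms(1,2) by (cases p) auto
  then have "gap b x (b - 1 - min (p - 1) (b - p)) (b - 1 - max (p - 1) (b - p))"
    using gap_kaprekar_zero[of b x p] True assms(1,3) by simp
  from gap_unique[OF assms(3) this] have p: "p = b - 1 - min (p - 1) (b - p)" "b - 1 \<le> max (p - 1) (b - p)"
    using True by auto
  then have "b - 1 \<le> p - 1 \<or> b - 1 \<le> b - p" by (simp only: le_max_iff_disj)
  then have "p = 1" using gap_bounds[OF assms(3)] \<open>p \<noteq> 0\<close> by linarith
  \<comment> \<open>Here \<open>p = 1\<close> gives b - 1 = 1, against \<open>b > 4\<close>.\<close>
  with p show ?thesis using assms(4) by simp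
next
  case False
  then have "q > 0" by simp
  have pq: "q \<le> p" "p < b" using gap_bounds[OF assms(3)] by auto
  consider "tent b q < tent b p" | "tent b p < tent b q" | "tent b p = tent b q" by linarith
  then show ?thesis
  proof cases
    case 1
    then have "p = tent b p" "q = tent b q"
      using gap_unique[OF assms(3) gap_kaprekar_greater[OF assms(3) \<open>q > 0\<close> 1, unfolded assms(1)]] by blast+
    \<comment> \<open>Both \<open>p\<close> and \<open>q\<close> would be b/3, contradicting the
      strict inequality.\<close>
    then show ?thesis using pq 1 tent_cases[of p b] tent_cases[of q b] by linarith
  next
    case 2
    then have "p = tent b q" "q = tent b p"
      using gap_unique[OF assms(3) gap_kaprekar_less[OF assms(3) \<open>q > 0\<close> 2, unfolded assms(1)]] by blast+
    \<comment> \<open>The bounds leave only p = b - 2q and q = 2p - b, whose solution is the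
      claim.\<close>
    then show ?thesis using pq 2 tent_cases[of p b] tent_cases[of q b] by linarith
  next
    case 3
    then have "p = tent b p + 1" "q = (tent b p - 1) + (1 - tent b p)"
      using gap_unique[OF assms(3) gap_kaprekar_equal[OF assms(3) \<open>q > 0\<close> 3, unfolded assms(1)]] by blast+
    moreover from this have "tent b p = 0 \<and> q = 1 \<or> tent b p = q + 1" using \<open>q > 0\<close> by linarith
    \<comment> \<open>Solutions occur only for b = 2 and for b = 4 with the pair (3, 1).\<close>
    ultimately show ?thesis
      using pq assms(4) 3 tent_cases[of p b] tent_cases[of q b] by linarith
  qed
qed

text \<open>Each step doubles the entries up to multiples of \<open>b\<close>, so they gain a factor
  2 as long as \<open>b\<close> still supplies it.\<close>

lemma gap_kaprekar_iterate_good: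
  assumes "gap b x p q" "good m p q" "b = m * c" "odd m" "m > 1" "5 dvd c" "2 ^ j dvd c"
  shows "\<exists>p q. gap b ((kaprekar b ^^ j) x) p q \<and> good m p q \<and> m * 2 ^ j dvd p \<and> m * 2 ^ j dvd q"
  using assms(7)
proof (induction j)
  case 0
  then show ?case using assms(1,2) by (auto simp: good_def)
next
  case (Suc j)
  then obtain p q where pq: "gap b ((kaprekar b ^^ j) x) p q" "good m p q"
    "m * 2 ^ j dvd p" "m * 2 ^ j dvd q"
    by (metis dvd_triv_right dvd_trans power_Suc)
  have "m * 2 ^ Suc j dvd b" using Suc.prems assms(3) by (simp add: mult_dvd_mono)
  moreover have "m * 2 ^ Suc j dvd 2 * p" "m * 2 ^ Suc j dvd 2 * q"
    using pq(3,4) by (simp_all add: mult.left_commute[of m])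
  ultimately have *: "m * 2 ^ Suc j dvd tent b p" "m * 2 ^ Suc j dvd tent b q"
    by (simp_all add: dvd_tent)
  obtain p' q' where p'q': "gap b (kaprekar b ((kaprekar b ^^ j) x)) p' q'"
    and "m * 2 ^ Suc j dvd p'" "m * 2 ^ Suc j dvd q'"
    using gap_kaprekar_good[OF pq(1,2) assms(3,4,6)] * by blast
  moreover have "good m p' q'"
    using good_kaprekar_iff[OF pq(1) p'q' assms(3-6)] pq(2) by simp
  ultimately show ?case by auto
qed

lemma gap_kaprekar_cycle:
  assumes "gap (5 * w) x (3 * w) w" "w > 0"
  shows "gap (5 * w) (kaprekar (5 * w) x) (3 * w) w"
proof -
  have "tent (5 * w) (3 * w) = w" "tent (5 * w) w = 3 * w" by (auto simp: tent_def)
  then show ?thesis using gap_kaprekar_less[OF assms] assms(2) by simp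
qed

lemma eventually_fixed_if_good:
  assumes "gap b x p q" "good m p q" "b = 5 * m * 2 ^ n" "odd m" "m > 1"
  shows "\<exists>c. c \<noteq> 0 \<and> (\<forall>\<^sub>F t in sequentially. (kaprekar b ^^ t) x = c)"
proof -
  define w where "w = m * 2 ^ n"
  have "w > 0" using assms(5) by (simp add: w_def)
  have b: "b = 5 * w" "b = m * (5 * 2 ^ n)" using assms(3) by (simp_all add: w_def)
  let ?x = "\<lambda>t. (kaprekar b ^^ t) x"
  obtain p' q' where gap': "gap b (?x n) p' q'" and good': "good m p' q'"
    and dvd: "w dvd p'" "w dvd q'"
    using gap_kaprekar_iterate_good[OF assms(1,2) b(2) assms(4,5), of n] by (auto simp: w_def)
  obtain y z where yz: "p' = w * y" "q' = w * z" using dvd unfolding dvd_def by blast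
  have "z > 0" using good' yz not_good_0 by (cases z) auto
  have "w * z \<le> w * y" "w * y < w * 5" using gap_bounds[OF gap'] yz b by auto
  then have "z \<le> y" "y < 5" using \<open>w > 0\<close> by auto
  have tent: "tent b p' = w * tent 5 y" "tent b q' = w * tent 5 z"
    using tent_mult[of w 5] by (simp_all add: b(1) yz mult.commute[of 5])
  have start: "gap b (?x (Suc n)) (3 * w) w"
  proof -
    \<comment> \<open>On 1, ..., 4 the map \<open>tent 5\<close> takes only the values 1 and 3.
      Goodness makes the two values distinct, so the ordered pair is (3w, w).\<close>
    have "y \<in> {1, 2, 3, 4}" "z \<in> {1, 2, 3, 4}"
      using \<open>z \<le> y\<close> \<open>y < 5\<close> \<open>z > 0\<close> by auto
    then show ?thesis
      using gap_kaprekar_good[OF gap' good' b(2) assms(4)] unfolding tent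
      by (auto simp: tent_def mult.commute)
  qed
  have cycle: "gap b (?x (Suc n + t)) (3 * w) w" for t
    using start gap_kaprekar_cycle \<open>w > 0\<close> b(1) by (induction t) auto
  \<comment> \<open>The pair is constant from step n + 1 on; an iterate is determined by its
    predecessor's pair, hence the bound n + 2.\<close>
  have "?x t + 3 * w + w * b = 3 * w * b ^ 3 + w * b ^ 2" if "t \<ge> n + 2" for t
  proof -
    obtain s where "t = Suc (Suc n + s)"
      using \<open>t \<ge> n + 2\<close> le_Suc_ex[of "n + 2" t] by auto
    then show ?thesis using kaprekar_gap[OF cycle[of s]] by simp
  qed
  note eq = this
  define C where "C = 3 * w * b ^ 3 + w * b ^ 2 - 3 * w - w * b"
  have "?x t = C" if "t \<ge> n + 2" for t
    unfolding C_def using eq[OF that] by linarith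
  then have "\<forall>\<^sub>F t in sequentially. ?x t = C" by (rule eventually_sequentiallyI)
  moreover have "C \<noteq> 0"
  proof -
    have "b > 1" using b(1) \<open>w > 0\<close> by simp
    then have "1 < b ^ 3" by (simp only: one_less_power)
    then have "w * b \<le> w * b ^ 2" "3 * w < 3 * w * b ^ 3"
      using \<open>w > 0\<close> by (simp_all add: power2_eq_square)
    then show ?thesis unfolding C_def by linarith
  qed
  ultimately show ?thesis by blast
qed

text \<open>The limit is a fixed point, its pair (3b/5, b/5) is good, and goodness transfers back
  along the orbit.\<close>

lemma good_if_eventually_fixed:
  assumes "gap b x p q" "b = 5 * m * 2 ^ n" "odd m" "m > 1"
    and "c \<noteq> 0" "\<forall>\<^sub>F t in sequentially. (kaprekar b ^^ t) x = c"
  shows "good m p q"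
proof -
  let ?x = "\<lambda>t. (kaprekar b ^^ t) x"
  have b: "b = m * (5 * 2 ^ n)" using assms(2) by simp
  have "b \<ge> 5 * m" using assms(2) by simp
  then have "b > 4" using assms(4) by linarith
  then have "b > 0" by simp
  obtain T where T: "\<And>t. t \<ge> T \<Longrightarrow> ?x t = c"
    using assms(6) by (auto simp: eventually_sequentially)
  have "kaprekar b c = c" using T[of T] T[of "Suc T"] by simp
  have good_iff: "good m p' q' \<longleftrightarrow> good m p q" if "gap b (?x t) p' q'" for t p' q'
    using that
  proof (induction t arbitrary: p' q')
    case 0
    then show ?case using gap_unique[OF assms(1)] by auto
  next
    case (Suc t)
    obtain p1 q1 where "gap b (?x t) p1 q1" using gap_exists[OF \<open>b > 0\<close>] by metis
    then show ?case using Suc good_kaprekar_iff[OF _ _ b assms(3,4)] by auto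
  qed
  obtain p' q' where gap': "gap b c p' q'" using gap_exists[OF \<open>b > 0\<close>] by metis
  then have "b = 5 * q'" "p' = 3 * q'"
    using gap_kaprekar_fixed_point[OF \<open>kaprekar b c = c\<close> _ gap'] assms(5) \<open>b > 4\<close> by auto
  then have q': "q' = m * 2 ^ n" "p' = m * (3 * 2 ^ n)" using assms(2) by auto
  have "(3 * 2 ^ n * 2 ^ n)\<^sup>2 mod 5 = (4 :: nat)"
  proof -
    have "(3 * 2 ^ n * 2 ^ n)\<^sup>2 = (9 * 16 ^ n :: nat)"
      by (simp add: power_mult_distrib power2_eq_square flip: power_mult_distrib)
    moreover have "9 * 16 ^ n mod 5 = (9 mod 5) * (16 mod 5) ^ n mod (5 :: nat)"
      by (metis mod_mult_eq mod_mult_right_eq power_mod)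
    ultimately show ?thesis by simp
  qed
  then have "good m p' q'" using q' assms(4) by (simp add: good_mult mult.assoc)
  then show ?thesis using good_iff[of T] gap' T by simp
qed

subsection \<open>Counting the inputs\<close>

lemma card_sort_digits4_eq:
  assumes "s0 \<le> s1" "s1 \<le> s2" "s2 \<le> s3" "s3 < b"
  shows "card {x. x < b ^ 4 \<and> sort (digits4 b x) = [s0, s1, s2, s3]} =
    card (permutations_of_multiset {#s0, s1, s2, s3#})"
proof (rule bij_betw_same_card)
  have inv: "digits4 b (horner_sum (\<lambda>d. d) b l) = l" and less: "horner_sum (\<lambda>d. d) b l < b ^ 4"
    if "mset l = {#s0, s1, s2, s3#}" for l
  proof -
    have len: "length l = 4" using arg_cong[OF that, of size] by simp
    have set: "set l \<subseteq> {..<b}" using arg_cong[OF that, of set_mset] assms by auto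
    show "horner_sum (\<lambda>d. d) b l < b ^ 4" using horner_sum_less_power[OF set] len by simp
    obtain w0 w1 w2 w3 where "l = [w0, w1, w2, w3]"
      using len by (auto simp: numeral_eq_Suc length_Suc_conv)
    then show "digits4 b (horner_sum (\<lambda>d. d) b l) = l"
      using set digits4_horner_sum[of w0 b w1 w2 w3] by (simp only:) auto
  qed
  have sort: "sort l = [s0, s1, s2, s3] \<longleftrightarrow> mset l = {#s0, s1, s2, s3#}" for l
  proof
    assume "sort l = [s0, s1, s2, s3]"
    then show "mset l = {#s0, s1, s2, s3#}" by (metis mset.simps mset_sort)
  next
    assume "mset l = {#s0, s1, s2, s3#}"
    then show "sort l = [s0, s1, s2, s3]" using assms by (intro properties_for_sort) auto
  qed
  show "bij_betw (digits4 b) {x. x < b ^ 4 \<and> sort (digits4 b x) = [s0, s1, s2, s3]}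
      (permutations_of_multiset {#s0, s1, s2, s3#})"
    by (rule bij_betw_byWitness[where f' = "horner_sum (\<lambda>d. d) b"])
      (auto simp: horner_sum_digits4 permutations_of_multiset_def sort inv less)
qed

text \<open>As \<open>s1 < s2\<close>, only the two lowest or the two highest digits can
  coincide.\<close>

lemma card_permutations_of_multiset_4:
  fixes s0 s1 s2 s3 :: nat
  assumes "s0 \<le> s1" "s1 < s2" "s2 \<le> s3"
  shows "card (permutations_of_multiset {#s0, s1, s2, s3#}) =
    24 div ((if s0 = s1 then 2 else 1) * (if s2 = s3 then 2 else 1))"
proof -
  have "s0 \<noteq> s2" "s0 \<noteq> s3" "s1 \<noteq> s2" "s1 \<noteq> s3" using assms by auto
  then have "(\<Prod>x\<in>set_mset {#s0, s1, s2, s3#}. fact (count {#s0, s1, s2, s3#} x)) =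
      (if s0 = s1 then 2 else 1) * (if s2 = s3 then 2 else 1 :: nat)"
    by (cases "s0 = s1"; cases "s2 = s3") simp_all
  moreover have "size {#s0, s1, s2, s3#} = 4" by simp
  moreover have "fact 4 = (24 :: nat)" by (simp add: fact_numeral)
  ultimately show ?thesis by (simp only: card_permutations_of_multiset(1))
qed

text \<open>The two end terms are 12 each, the r - 1 inner ones 24.\<close>

lemma sum_end_weights:
  fixes r :: nat
  assumes "r > 0"
  shows "(\<Sum>e\<le>r. 24 div ((if e = 0 then 2 else 1) * (if e = r then 2 else 1))) = 24 * r"
proof -
  obtain k where r: "r = Suc k" using assms gr0_implies_Suc by blast
  have "{..r} = insert 0 (insert r {1..k})" using r by auto
  then show ?thesis by (simp add: r)
qed

text \<open>There are b - p choices of the smallest digit \<open>d\<close>. The end values of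
  \<open>e\<close> are those where two digits coincide, which halves the number of
  arrangements.\<close>

lemma card_gap:
  assumes "0 < q" "q < p" "p < b"
  shows "card {x. x < b ^ 4 \<and> gap b x p q} = 24 * (b - p) * (p - q)"
proof -
  define F where "F = (\<lambda>(d, e). {x. x < b ^ 4 \<and> sort (digits4 b x) = [d, d + e, d + e + q, d + p]})"
  have "{x. x < b ^ 4 \<and> gap b x p q} = (\<Union>i \<in> {..<b - p} \<times> {..p - q}. F i)"
    using assms by (auto simp: gap_def F_def)
  also have "card \<dots> = (\<Sum>i \<in> {..<b - p} \<times> {..p - q}. card (F i))"
    by (rule card_UN_disjoint) (auto simp: F_def)
  also have "\<dots> = (\<Sum>d<b - p. \<Sum>e\<le>p - q. card (F (d, e)))"
    by (simp add: sum.cartesian_product)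
  also have "\<dots> = (\<Sum>d<b - p. \<Sum>e\<le>p - q.
      24 div ((if e = 0 then 2 else 1) * (if e = p - q then 2 else 1)))"
  proof (intro sum.cong refl)
    fix d e assume "d \<in> {..<b - p}" "e \<in> {..p - q}"
    then have de: "d + p < b" "e + q \<le> p" using assms by auto
    then have "card (F (d, e)) = card (permutations_of_multiset {#d, d + e, d + e + q, d + p#})"
      by (simp only: F_def prod.case, intro card_sort_digits4_eq) auto
    also have "\<dots> = 24 div ((if d = d + e then 2 else 1) * (if d + e + q = d + p then 2 else 1))"
      using de assms by (intro card_permutations_of_multiset_4) auto
    also have "d = d + e \<longleftrightarrow> e = 0" by auto
    also have "d + e + q = d + p \<longleftrightarrow> e = p - q" using de assms by auto
    finally show "card (F (d, e)) = 24 div ((if e = 0 then 2 else 1) * (if e = p - q then 2 else 1))" .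
  qed
  also have "\<dots> = 24 * (b - p) * (p - q)"
    using assms by (subst sum_end_weights) auto
  finally show ?thesis .
qed

section \<open>Summation over residue classes modulo 5\<close>

lemma sum_lessThan_5_Suc:
  fixes f :: "nat \<Rightarrow> 'a :: comm_monoid_add"
  shows "sum f {..<5 * Suc i} =
    sum f {..<5 * i} + f (5 * i) + f (5 * i + 1) + f (5 * i + 2) + f (5 * i + 3) + f (5 * i + 4)"
proof -
  have "5 * Suc i = Suc (Suc (Suc (Suc (Suc (5 * i)))))" by simp
  then show ?thesis by (simp add: numeral_eq_Suc)
qed

lemma mod_5_simps:
  fixes i :: nat
  shows "5 * i mod 5 = 0" "(5 * i + 1) mod 5 = 1" "(5 * i + 2) mod 5 = 2"
    "(5 * i + 3) mod 5 = 3" "(5 * i + 4) mod 5 = 4"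
  by presburger+

text \<open>Each block of five contributes 2Y - 10i - 5, and residues 2 and 3 give the same
  amount.\<close>

lemma sum_residues_1_4:
  "(\<Sum>z<5 * i. if z mod 5 \<in> {1, 4} then Y - int z else 0) = 2 * Y * int i - 5 * int i ^ 2"
proof (induction i)
  case (Suc i)
  show ?case unfolding sum_lessThan_5_Suc mod_5_simps Suc.IH
    by (simp add: algebra_simps power2_eq_square)
qed simp

lemma sum_residues_2_3:
  "(\<Sum>z<5 * i. if z mod 5 \<in> {2, 3} then Y - int z else 0) = 2 * Y * int i - 5 * int i ^ 2"
proof (induction i)
  case (Suc i)
  show ?case unfolding sum_lessThan_5_Suc mod_5_simps Suc.IH
    by (simp add: algebra_simps power2_eq_square)
qed simp

lemma square_mult_mod_5_eq_4_iff:
  fixes y z :: nat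
  shows "(y * z)\<^sup>2 mod 5 = 4 \<longleftrightarrow>
    y mod 5 \<in> {1, 4} \<and> z mod 5 \<in> {2, 3} \<or> y mod 5 \<in> {2, 3} \<and> z mod 5 \<in> {1, 4}"
proof -
  have "(y * z)\<^sup>2 mod 5 = ((y mod 5) * (z mod 5))\<^sup>2 mod 5"
    by (metis mod_mult_eq power_mod)
  moreover have "y mod 5 \<in> {0, 1, 2, 3, 4}" "z mod 5 \<in> {0, 1, 2, 3, 4}" by auto
  ultimately show ?thesis by (elim insertE emptyE) simp_all
qed

text \<open>The factor 3 clears denominators. \<open>C\<close> is separate from \<open>k\<close> so
  that it stays fixed during the induction.\<close>

lemma sum_square_mult_mod_5_eq_4:
  "3 * (\<Sum>y<5 * k. \<Sum>z<y. if (y * z)\<^sup>2 mod 5 = 4 then (C - int y) * (int y - int z) else 0) =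
    C * (20 * int k ^ 3 - 2 * int k) - 75 * int k ^ 4 + 15 * int k ^ 2"
proof -
  define W where "W = (\<lambda>y. \<Sum>z<y. if (y * z)\<^sup>2 mod 5 = 4 then int y - int z else 0)"
  \<comment> \<open>Each value combines the full blocks below 5i with the few remaining terms; the
    residue of y selects the admissible residues of z.\<close>
  have W: "W (5 * i) = 0" "W (5 * i + 1) = 5 * int i ^ 2 + 2 * int i"
    "W (5 * i + 2) = 5 * int i ^ 2 + 4 * int i + 1"
    "W (5 * i + 3) = 5 * int i ^ 2 + 6 * int i + 2"
    "W (5 * i + 4) = 5 * int i ^ 2 + 8 * int i + 3" for i
  proof -
    define f where "f = (\<lambda>R y z. if z mod 5 \<in> R then int y - int z else 0)"
    have f14: "sum (f {1, 4} y) {..<5 * i} = 2 * int y * int i - 5 * int i ^ 2" for y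
      unfolding f_def by (rule sum_residues_1_4)
    have f23: "sum (f {2, 3} y) {..<5 * i} = 2 * int y * int i - 5 * int i ^ 2" for y
      unfolding f_def by (rule sum_residues_2_3)
    have upto: "sum g {..<5 * i + 1} = sum g {..<5 * i} + g (5 * i)"
      "sum g {..<5 * i + 2} = sum g {..<5 * i} + g (5 * i) + g (5 * i + 1)"
      "sum g {..<5 * i + 3} = sum g {..<5 * i} + g (5 * i) + g (5 * i + 1) + g (5 * i + 2)"
      "sum g {..<5 * i + 4} = sum g {..<5 * i} + g (5 * i) + g (5 * i + 1) + g (5 * i + 2) + g (5 * i + 3)"
      for g :: "nat \<Rightarrow> int"
      by (simp_all add: numeral_eq_Suc)
    have f: "f R y (5 * i) = (if 0 \<in> R then int y - 5 * int i else 0)"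
      "f R y (5 * i + 1) = (if 1 \<in> R then int y - 5 * int i - 1 else 0)"
      "f R y (5 * i + 2) = (if 2 \<in> R then int y - 5 * int i - 2 else 0)"
      "f R y (5 * i + 3) = (if 3 \<in> R then int y - 5 * int i - 3 else 0)" for R y
      unfolding f_def mod_5_simps by simp_all
    have "W (5 * i + 1) = sum (f {2, 3} (5 * i + 1)) {..<5 * i + 1}"
      "W (5 * i + 2) = sum (f {1, 4} (5 * i + 2)) {..<5 * i + 2}"
      "W (5 * i + 3) = sum (f {1, 4} (5 * i + 3)) {..<5 * i + 3}"
      "W (5 * i + 4) = sum (f {2, 3} (5 * i + 4)) {..<5 * i + 4}"
      unfolding W_def f_def square_mult_mod_5_eq_4_iff mod_5_simps by simp_all
    then show "W (5 * i + 1) = 5 * int i ^ 2 + 2 * int i"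
      "W (5 * i + 2) = 5 * int i ^ 2 + 4 * int i + 1"
      "W (5 * i + 3) = 5 * int i ^ 2 + 6 * int i + 2"
      "W (5 * i + 4) = 5 * int i ^ 2 + 8 * int i + 3"
      unfolding upto f14 f23 f by (simp_all add: algebra_simps power2_eq_square)
    show "W (5 * i) = 0"
      unfolding W_def square_mult_mod_5_eq_4_iff mod_5_simps by simp
  qed
  have "3 * (\<Sum>y<5 * k. (C - int y) * W y) =
    C * (20 * int k ^ 3 - 2 * int k) - 75 * int k ^ 4 + 15 * int k ^ 2"
  proof (induction k)
    case (Suc i)
    show ?case unfolding sum_lessThan_5_Suc W distrib_left Suc.IH
      by (simp add: algebra_simps power2_eq_square power3_eq_cube power4_eq_xxxx)
  qed simp
  also have "(\<lambda>y. (C - int y) * W y) =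
    (\<lambda>y. \<Sum>z<y. if (y * z)\<^sup>2 mod 5 = 4 then (C - int y) * (int y - int z) else 0)"
    unfolding W_def by (intro ext) (simp add: sum_distrib_left if_distrib cong: if_cong)
  finally show ?thesis .
qed

text \<open>Membership is goodness of the initial pair. The strict bound on z reflects that a good
  pair has distinct entries.\<close>

lemma kaprekar_set_eq:
  assumes "b = 5 * m * 2 ^ n" "odd m" "m > 1"
  shows "kaprekar_set b =
    (\<Union>(y, z) \<in> (SIGMA y : {..<5 * 2 ^ n}. {z \<in> {..<y}. (y * z)\<^sup>2 mod 5 = 4}).
      {x. x < b ^ 4 \<and> gap b x (m * y) (m * z)})" (is "_ = ?U")
proof (intro set_eqI iffI)
  fix x assume "x \<in> kaprekar_set b"
  then obtain c where x: "x < b ^ 4" and c: "c \<noteq> 0" "\<forall>\<^sub>F t in sequentially. (kaprekar b ^^ t) x = c"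
    by (auto simp: kaprekar_set_def)
  have "b > 0" using assms by simp
  then obtain p q where gap: "gap b x p q" by (rule gap_exists)
  have "good m p q" by (rule good_if_eventually_fixed[OF gap assms c])
  moreover obtain y z where yz: "p = m * y" "q = m * z"
    using \<open>good m p q\<close> unfolding good_def dvd_def by blast
  ultimately have "(y * z)\<^sup>2 mod 5 = 4" using assms(3) by (simp add: good_mult)
  moreover have "z \<noteq> y" using \<open>good m p q\<close> not_good_same yz by metis
  moreover have "m * z \<le> m * y" "m * y < m * (5 * 2 ^ n)"
    using gap_bounds[OF gap] by (simp_all add: yz assms(1))
  then have "z \<le> y" "y < 5 * 2 ^ n" using assms(3) by auto
  ultimately show "x \<in> ?U"
    using x gap by (auto simp: yz intro!: bexI[of _ y] exI[of _ z])
next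
  fix x assume "x \<in> ?U"
  then obtain y z where "x < b ^ 4" "gap b x (m * y) (m * z)" "(y * z)\<^sup>2 mod 5 = 4"
    by auto
  then show "x \<in> kaprekar_set b"
    using eventually_fixed_if_good[OF _ _ assms] assms(3) by (simp add: kaprekar_set_def good_mult)
qed

lemma card_kaprekar_set:
  assumes "b = 5 * m * 2 ^ n" "odd m" "m > 1"
  shows "card (kaprekar_set b) = 40 * m\<^sup>2 * 4 ^ n * (5 * 4 ^ n + 1)"
proof -
  define k :: nat where "k = 2 ^ n"
  have b: "b = 5 * m * k" using assms(1) by (simp add: k_def)
  define H where "H = (SIGMA y : {..<5 * k}. {z \<in> {..<y}. (y * z)\<^sup>2 mod 5 = 4})"
  have "card (kaprekar_set b) =
      (\<Sum>(y, z)\<in>H. card {x. x < b ^ 4 \<and> gap b x (m * y) (m * z)})"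
  proof -
    have "kaprekar_set b = (\<Union>i\<in>H. {x. x < b ^ 4 \<and> gap b x (m * fst i) (m * snd i)})"
      using kaprekar_set_eq[OF assms] by (simp add: H_def k_def case_prod_beta)
    also have "card \<dots> = (\<Sum>i\<in>H. card {x. x < b ^ 4 \<and> gap b x (m * fst i) (m * snd i)})"
    proof (rule card_UN_disjoint)
      show "finite H" by (simp add: H_def)
      have "m * fst i = m * fst j \<and> m * snd i = m * snd j \<Longrightarrow> i = j" for i j
        using assms(3) by (simp add: prod_eq_iff)
      then show "\<forall>i\<in>H. \<forall>j\<in>H. i \<noteq> j \<longrightarrow> {x. x < b ^ 4 \<and> gap b x (m * fst i) (m * snd i)} \<inter>
          {x. x < b ^ 4 \<and> gap b x (m * fst j) (m * snd j)} = {}"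
        using gap_unique by blast
    qed simp
    finally show ?thesis by (simp add: case_prod_beta)
  qed
  also have "\<dots> = (\<Sum>(y, z)\<in>H. 24 * (b - m * y) * (m * y - m * z))"
  proof (intro sum.cong refl, clarify)
    fix y z assume "(y, z) \<in> H"
    then have yz: "z < y" "y < 5 * k" "(y * z)\<^sup>2 mod 5 = 4" by (auto simp: H_def)
    \<comment> \<open>For z = 0 the residue would be 0 instead of 4.\<close>
    then have "z > 0" by (cases z) auto
    then have "0 < m * z" "m * z < m * y" "m * y < b"
      using yz assms(3) by (auto simp: b)
    then show "card {x. x < b ^ 4 \<and> gap b x (m * y) (m * z)} = 24 * (b - m * y) * (m * y - m * z)"
      by (rule card_gap)
  qed
  finally have "int (card (kaprekar_set b)) = (\<Sum>(y, z)\<in>H. int (24 * (b - m * y) * (m * y - m * z)))"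
    by (simp add: case_prod_beta)
  also have "\<dots> = (\<Sum>(y, z)\<in>H. 24 * int m ^ 2 * ((5 * int k - int y) * (int y - int z)))"
  proof (intro sum.cong refl, clarify)
    fix y z assume "(y, z) \<in> H"
    then have "z < y" "y < 5 * k" by (auto simp: H_def)
    then have "m * z \<le> m * y" "m * y \<le> b" by (auto simp: b)
    then have "int (24 * (b - m * y) * (m * y - m * z)) =
        24 * (int b - int m * int y) * (int m * int y - int m * int z)"
      by (simp add: of_nat_diff)
    also have "\<dots> = 24 * int m ^ 2 * ((5 * int k - int y) * (int y - int z))"
      by (simp add: b algebra_simps power2_eq_square)
    finally show "int (24 * (b - m * y) * (m * y - m * z)) =
        24 * int m ^ 2 * ((5 * int k - int y) * (int y - int z))" .
  qed
  also have "\<dots> = 24 * int m ^ 2 * (\<Sum>(y, z)\<in>H. (5 * int k - int y) * (int y - int z))"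
    by (simp add: sum_distrib_left case_prod_beta)
  also have "(\<Sum>(y, z)\<in>H. (5 * int k - int y) * (int y - int z)) =
      (\<Sum>y<5 * k. \<Sum>z<y. if (y * z)\<^sup>2 mod 5 = 4 then (5 * int k - int y) * (int y - int z) else 0)"
    unfolding H_def by (subst sum.Sigma[symmetric]) (simp_all add: sum.If_cases Int_def)
  \<comment> \<open>The sum formula is used with C = 5k.\<close>
  finally have "3 * int (card (kaprekar_set b)) = 24 * int m ^ 2 *
      (5 * int k * (20 * int k ^ 3 - 2 * int k) - 75 * int k ^ 4 + 15 * int k ^ 2)"
    using sum_square_mult_mod_5_eq_4[of "5 * int k" k] by simp
  also have "\<dots> = 3 * int (40 * m\<^sup>2 * k\<^sup>2 * (5 * k\<^sup>2 + 1))"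
    by (simp add: algebra_simps power2_eq_square power3_eq_cube power4_eq_xxxx)
  finally have "card (kaprekar_set b) = 40 * m\<^sup>2 * k\<^sup>2 * (5 * k\<^sup>2 + 1)" by linarith
  moreover have "k\<^sup>2 = 4 ^ n" by (simp add: k_def power2_eq_square flip: power_mult_distrib)
  ultimately show ?thesis by simp
qed

theorem theorem1p2:
  fixes b m n :: nat
  assumes "odd m" and "m > 1" and "b = 5 * m * 2 ^ n"
  shows "kaprekar_fraction b = real (card (kaprekar_set b)) / real b ^ 4
    \<and> real (card (kaprekar_set b)) / real b ^ 4 = (8 + 40 * 4 ^ n) / (5 * real b ^ 2)
    \<and> (8 + 40 * 4 ^ n) / (5 * real b ^ 2) = 8 / (5 * real b ^ 2) + 8 / (25 * real m ^ 2)"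
proof -
  have "real b > 0" "real m > 0" using assms by auto
  \<comment> \<open>This turns the factor 40 m^2 4^n of the count into 8 b^2 / 5.\<close>
  have b2: "real b ^ 2 = 25 * real m ^ 2 * 4 ^ n"
    by (simp add: assms(3) power2_eq_square flip: power_mult_distrib)
  have "real (card (kaprekar_set b)) = 40 * real m ^ 2 * 4 ^ n * (5 * 4 ^ n + 1)"
    using card_kaprekar_set[OF assms(3,1,2)] by (simp add: algebra_simps)
  also have "\<dots> = 8 / 5 * real b ^ 2 * (5 * 4 ^ n + 1)"
    by (simp add: b2)
  finally have "real (card (kaprekar_set b)) / real b ^ 4 = (8 + 40 * 4 ^ n) / (5 * real b ^ 2)"
    using \<open>real b > 0\<close> by (simp add: field_simps power2_eq_square power4_eq_xxxx)
  moreover have "(8 + 40 * 4 ^ n) / (5 * real b ^ 2) = 8 / (5 * real b ^ 2) + 8 / (25 * real m ^ 2)"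
    using \<open>real m > 0\<close> by (simp add: b2 field_simps)
  ultimately show ?thesis by (simp add: kaprekar_fraction_def)
qed

end
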